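(* Let $\mathcal{A}=\{a_1,a_2,\ldots\}$ and $\mathcal{B}=\{b_1,b_2,\ldots\}$ be infinite sets of non-negative integers, listed in increasing order, and let $\mathcal{S}=\{a_i+b_j : 1\le i<j\}$. Then there exist uncountably many transcendental functions \[ f(z)=\sum_{n\in\mathcal{S}}c_nz^n\in\mathbb{Z}\{z\} \] such that $f\big(\overline{\mathbb{Q}}\cap B(0,1)\big)\subseteq\overline{\mathbb{Q}}$.
   Context: $\mathbb{Z}\{z\}$ denotes the set of power series with integer coefficients converging on the open unit disc $B(0,1)$; writing $f=\sum_{n\in\mathcal{S}}c_nz^n$ means the coefficients of indices outside $\mathcal{S}$ vanish. A function is transcendental if it is not algebraic over $\mathbb{C}(z)$. $\overline{\mathbb{Q}}$ is the set of algebraic numbers. *)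

theory Defs
  imports "HOL-Complex_Analysis.Complex_Analysis" "HOL-Computational_Algebra.Computational_Algebra"
begin

(* For K a subfield of 'a; the same shape as the library's algebraic, which is the case K = \<rat>. *)
definition algebraic_over :: "'a::field set \<Rightarrow> 'a \<Rightarrow> bool" where
  "algebraic_over K x \<longleftrightarrow> (\<exists>p. (\<forall>i. coeff p i \<in> K) \<and> p \<noteq> 0 \<and> poly p x = 0)"

(* The field C(z), embedded in C((z)) by Laurent expansion at 0. *)
definition rational_functions :: "complex fls set" where
  "rational_functions =
     {fps_to_fls (fps_of_poly p) / fps_to_fls (fps_of_poly q) | p q. q \<noteq> 0}"

(* A function analytic on B(0,1) is identified with its power series at 0, an element of C((z)). *)
definition transcendental_function :: "complex fps \<Rightarrow> bool" where
  "transcendental_function f \<longleftrightarrow> \<not> algebraic_over rational_functions (fps_to_fls f)"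

definition int_series_on_disc :: "complex fps set" where
  "int_series_on_disc =
     {f. (\<forall>n. fps_nth f n \<in> \<int>) \<and> (\<forall>z\<in>ball 0 1. summable (\<lambda>n. fps_nth f n * z ^ n))}"

(* enumerate lists an infinite set of naturals increasingly from index 0; starting at 0 instead
   of 1 does not change the condition i < j. *)
definition upper_sumset :: "nat set \<Rightarrow> nat set \<Rightarrow> nat set" where
  "upper_sumset A B = {enumerate A i + enumerate B j | i j. i < j}"

definition algebraic_numbers :: "complex set" where
  "algebraic_numbers = {z. algebraic z}"

end

theory Submission
  imports Defs
begin

text \<open>
  For every nonzero integer polynomial \<open>P\<close>, more than \<open>degree P\<close> of the monomials \<open>z^a\<close> with
  \<open>a \<in> A\<close> are linearly dependent modulo \<open>P\<close>. So there are nonzero integer polynomials \<open>Q\<^sub>k\<close>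
  supported on \<open>A\<close> that vanish at all roots of the first \<open>k\<close> integer polynomials in some enumeration.
  Take \<open>f = \<Sum>k. \<epsilon>\<^sub>k z^(b\<^sub>k) Q\<^sub>k\<close> with \<open>\<epsilon>\<^sub>k \<in> {1, 2}\<close> and \<open>b\<^sub>k \<in> B\<close> growing very rapidly. At an
  algebraic point all but finitely many blocks vanish, so the value is algebraic. As \<open>b\<^sub>k\<close> dominates
  the coefficients of \<open>Q\<^sub>k\<close>, the coefficients of \<open>f\<close> grow at most quadratically. If
  \<open>R(z, f) = 0\<close> with \<open>R \<noteq> 0\<close>, the gaps between the blocks force \<open>R(z, F) = 0\<close> for all long partial
  sums \<open>F\<close>, which is too many roots. Distinct \<open>\<epsilon>\<close> give distinct \<open>f\<close>.
\<close>

section \<open>Integer linear relations and algebraic values\<close>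

text \<open>Fraction-free Gaussian elimination: with a nonzero pivot \<open>f i0 j0\<close>,
  cross-multiplication removes the coordinate \<open>j0\<close> from the other vectors without
  leaving the domain.\<close>

lemma linear_dependence:
  fixes f :: "'i \<Rightarrow> 'j \<Rightarrow> 'a::idom"
  assumes "finite J" "finite I" "card J < card I"
  shows "\<exists>c. (\<exists>i\<in>I. c i \<noteq> 0) \<and> (\<forall>j\<in>J. (\<Sum>i\<in>I. c i * f i j) = 0)"
  using assms
proof (induction J arbitrary: I f rule: finite_induct)
  case empty
  then obtain i where "i \<in> I" by fastforce
  then show ?case by (intro exI[of _ "\<lambda>_. 1"]) auto
next
  case (insert j0 J)
  show ?case
  proof (cases "\<forall>i\<in>I. f i j0 = 0")
    case True
    obtain c where "\<exists>i\<in>I. c i \<noteq> 0" "\<forall>j\<in>J. (\<Sum>i\<in>I. c i * f i j) = 0"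
      using insert.IH[of I f] insert.prems insert.hyps by auto
    then show ?thesis using True by (intro exI[of _ c]) auto
  next
    case False
    then obtain i0 where i0: "i0 \<in> I" "f i0 j0 \<noteq> 0" by auto
    define I' where "I' = I - {i0}"
    have I': "finite I'" "I = insert i0 I'" "i0 \<notin> I'" using i0 insert.prems by (auto simp: I'_def)
    have "card J < card I'" using insert.prems insert.hyps I' by simp
    then obtain c where c: "\<exists>i\<in>I'. c i \<noteq> 0"
      "\<forall>j\<in>J. (\<Sum>i\<in>I'. c i * (f i0 j0 * f i j - f i j0 * f i0 j)) = 0"
      using insert.IH[of I' "\<lambda>i j. f i0 j0 * f i j - f i j0 * f i0 j"] I' by auto
    \<comment> \<open>Scaling \<open>c\<close> by the pivot keeps it nontrivial, as there are no
      zero divisors; the entry at \<open>i0\<close> is the one that cancels coordinate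
      \<open>j0\<close>.\<close>
    define d where "d = (\<lambda>i. if i = i0 then - (\<Sum>i\<in>I'. c i * f i j0) else f i0 j0 * c i)"
    have eq: "(\<Sum>i\<in>I. d i * f i j) = (\<Sum>i\<in>I'. c i * (f i0 j0 * f i j - f i j0 * f i0 j))" for j
    proof -
      have "(\<Sum>i\<in>I. d i * f i j) = d i0 * f i0 j + (\<Sum>i\<in>I'. d i * f i j)"
        using I' by simp
      also have "(\<Sum>i\<in>I'. d i * f i j) = (\<Sum>i\<in>I'. f i0 j0 * c i * f i j)"
        by (rule sum.cong) (use I' in \<open>auto simp: d_def\<close>)
      also have "d i0 * f i0 j = - (\<Sum>i\<in>I'. c i * f i j0 * f i0 j)"
        by (simp add: d_def sum_distrib_right)
      finally show ?thesis
        by (simp add: sum_negf[symmetric] sum.distrib[symmetric] algebra_simps)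
    qed
    have "\<exists>i\<in>I. d i \<noteq> 0" using c(1) i0 I' by (auto simp: d_def)
    moreover have "(\<Sum>i\<in>I. d i * f i j0) = 0" unfolding eq by (simp add: algebra_simps)
    ultimately show ?thesis using c(2) eq by (intro exI[of _ d]) auto
  qed
qed

abbreviation ipoly :: "int poly \<Rightarrow> complex \<Rightarrow> complex" where
  "ipoly p \<equiv> poly (map_poly of_int p)"

lemma ipoly_add: "ipoly (p + q) x = ipoly p x + ipoly q x"
proof -
  have "map_poly of_int (p + q) = map_poly complex_of_int p + map_poly of_int q"
    by (rule poly_eqI) (simp add: coeff_map_poly)
  then show ?thesis by simp
qed

lemma ipoly_mult: "ipoly (p * q) x = ipoly p x * ipoly q x"
proof -
  have "map_poly of_int (p * q) = map_poly complex_of_int p * map_poly of_int q"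
    by (rule poly_eqI) (simp add: coeff_map_poly coeff_mult)
  then show ?thesis by simp
qed

lemma ipoly_smult: "ipoly (smult c p) x = of_int c * ipoly p x"
  by (simp add: map_poly_smult)

lemma ipoly_monom: "ipoly (monom c n) x = of_int c * x ^ n"
  by (simp add: map_poly_monom poly_monom)

lemma ipoly_power: "ipoly (p ^ n) x = ipoly p x ^ n"
  by (induction n) (simp_all add: ipoly_mult)

lemma ipoly_sum: "ipoly (\<Sum>i\<in>A. f i) x = (\<Sum>i\<in>A. ipoly (f i) x)"
  by (induction A rule: infinite_finite_induct) (simp_all add: ipoly_add)

text \<open>The disjunct \<open>p = 0\<close> admits \<open>n = 0\<close>, which occurs for
  remainders modulo a nonzero constant.\<close>

lemma ipoly_altdef:
  assumes "degree p < n \<or> p = 0"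
  shows "ipoly p x = (\<Sum>i<n. of_int (coeff p i) * x ^ i)"
proof -
  have "ipoly p x = (\<Sum>i\<le>degree p. of_int (coeff p i) * x ^ i)"
    by (simp add: poly_altdef degree_map_poly coeff_map_poly)
  also have "\<dots> = (\<Sum>i<n. of_int (coeff p i) * x ^ i)"
  proof (cases "p = 0")
    case False
    then show ?thesis using assms
      by (intro sum.mono_neutral_left) (auto simp: coeff_eq_0 not_le)
  qed simp
  finally show ?thesis .
qed

text \<open>The \<open>q i\<close> are reduced by pseudo-division, since \<open>p\<close> need not be monic.\<close>

lemma int_poly_relation_on_roots:
  fixes p :: "int poly" and q :: "nat \<Rightarrow> int poly"
  assumes "p \<noteq> 0"
  obtains c :: "nat \<Rightarrow> int" where "\<exists>i\<le>degree p. c i \<noteq> 0"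
    and "\<And>x. ipoly p x = 0 \<Longrightarrow> (\<Sum>i\<le>degree p. of_int (c i) * ipoly (q i) x) = 0"
proof -
  define r where "r i = pseudo_mod (q i) p" for i
  have "\<exists>a s. a \<noteq> 0 \<and> smult a (q i) = p * s + r i" for i
    using pseudo_mod(1)[OF assms] unfolding r_def by blast
  then obtain a s where a: "\<And>i. a i \<noteq> 0" "\<And>i. smult (a i) (q i) = p * s i + r i" by metis
  have r: "degree (r i) < degree p \<or> r i = 0" for i
    using pseudo_mod(2)[OF assms] unfolding r_def by blast
  \<comment> \<open>There are \<open>degree p + 1\<close> remainders, each with only
    \<open>degree p\<close> coefficients.\<close>
  obtain c where c: "\<exists>i\<in>{..degree p}. c i \<noteq> 0"
    "\<forall>j\<in>{..<degree p}. (\<Sum>i\<in>{..degree p}. c i * coeff (r i) j) = 0"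
    using linear_dependence[of "{..<degree p}" "{..degree p}" "\<lambda>i j. coeff (r i) j"] by auto
  show thesis
  proof
    \<comment> \<open>At a root of \<open>p\<close>, \<open>r i\<close> takes the value of
      \<open>smult (a i) (q i)\<close>, so the relation among the remainders passes to the
      \<open>q i\<close> with coefficients \<open>c i * a i\<close>.\<close>
    show "\<exists>i\<le>degree p. c i * a i \<noteq> 0" using c(1) a(1) by auto
    fix x assume x: "ipoly p x = 0"
    have *: "of_int (a i) * ipoly (q i) x = (\<Sum>j<degree p. of_int (coeff (r i) j) * x ^ j)" for i
      using arg_cong[OF a(2)[of i], of "\<lambda>p. ipoly p x"] x ipoly_altdef[OF r]
      by (simp add: ipoly_smult ipoly_add ipoly_mult)
    have "(\<Sum>i\<le>degree p. of_int (c i * a i) * ipoly (q i) x)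
        = (\<Sum>i\<le>degree p. \<Sum>j<degree p. of_int (c i * coeff (r i) j) * x ^ j)"
      by (simp add: * mult.assoc sum_distrib_left)
    also have "\<dots> = (\<Sum>j<degree p. of_int (\<Sum>i\<le>degree p. c i * coeff (r i) j) * x ^ j)"
      by (subst sum.swap) (simp add: sum_distrib_right)
    also have "\<dots> = 0"
      by (rule sum.neutral) (use c(2) in simp)
    finally show "(\<Sum>i\<le>degree p. of_int (c i * a i) * ipoly (q i) x) = 0" .
  qed
qed

text \<open>The powers of \<open>g\<close> satisfy a nontrivial integer relation at the roots of a
  polynomial annihilating \<open>x\<close>; its coefficients form a polynomial that annihilates
  \<open>ipoly g x\<close>.\<close>

lemma algebraic_ipoly:
  assumes "algebraic x"
  shows "algebraic (ipoly g x)"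
proof -
  obtain p where p: "p \<noteq> 0" "ipoly p x = 0" using algebraicE'[OF assms] by blast
  obtain c where c: "\<exists>i\<le>degree p. c i \<noteq> 0"
    "\<And>x. ipoly p x = 0 \<Longrightarrow> (\<Sum>i\<le>degree p. of_int (c i) * ipoly (g ^ i) x) = 0"
    using int_poly_relation_on_roots[OF p(1), of "\<lambda>i. g ^ i"] by blast
  define h where "h = (\<Sum>i\<le>degree p. monom (c i) i)"
  have h: "coeff h i = (if i \<le> degree p then c i else 0)" for i
    by (simp add: h_def coeff_sum)
  show ?thesis
  proof (rule algebraicI)
    show "coeff (map_poly of_int h) i \<in> \<int>" for i by (simp add: coeff_map_poly)
    show "map_poly of_int h \<noteq> (0 :: complex poly)"
    proof -
      have "h \<noteq> 0" using c(1) h by (metis coeff_0)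
      then show ?thesis by (simp add: map_poly_eq_0_iff)
    qed
    show "ipoly h (ipoly g x) = 0"
      using c(2)[OF p(2)] by (simp add: h_def ipoly_sum ipoly_monom ipoly_power)
  qed
qed

section \<open>Transcendence from rapid polynomial approximation\<close>

lemma fps_X_power_dvd_iff:
  fixes f :: "'a::field fps"
  shows "fps_X ^ n dvd f \<longleftrightarrow> (\<forall>i<n. fps_nth f i = 0)"
proof (cases "f = 0")
  case False
  show ?thesis
  proof
    assume "fps_X ^ n dvd f"
    then have "n \<le> subdegree f" using False by (simp add: fps_dvd_iff fps_X_power_subdegree)
    then show "\<forall>i<n. fps_nth f i = 0" by (auto intro: nth_less_subdegree_zero)
  next
    assume "\<forall>i<n. fps_nth f i = 0"
    then have "n \<le> subdegree f" using False by (intro subdegree_geI) auto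
    then show "fps_X ^ n dvd f" using False by (simp add: fps_dvd_iff fps_X_power_subdegree)
  qed
qed simp

text \<open>Each Horner step adds at most \<open>degree F\<close> beyond the degree of a coefficient
  of \<open>R\<close>. What matters is that \<open>D\<close> and \<open>d\<close> do not depend on
  \<open>F\<close>.\<close>

lemma degree_poly_le:
  fixes R :: "'a::comm_ring_1 poly poly"
  obtains D d where "\<And>F. degree (poly R F) \<le> D + d * degree F"
proof -
  have "\<exists>D d. \<forall>F. degree (poly R F) \<le> D + d * degree F"
  proof (induction R)
    case 0
    show ?case by auto
  next
    case (pCons a R)
    then obtain D d where IH: "\<And>F. degree (poly R F) \<le> D + d * degree F" by blast
    have "degree (poly (pCons a R) F) \<le> (degree a + D) + (d + 1) * degree F" for F
    proof -
      have "degree (F * poly R F) \<le> degree F + (D + d * degree F)"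
        using degree_mult_le[of F "poly R F"] IH[of F] by linarith
      then have "degree (a + F * poly R F) \<le> (degree a + D) + (d + 1) * degree F"
        by (intro degree_add_le) auto
      then show ?thesis by simp
    qed
    then show ?case by blast
  qed
  then show thesis using that by blast
qed

text \<open>Two termwise differentiations of the geometric series.\<close>

lemma summable_square_times_geometric:
  fixes r :: real
  assumes "norm r < 1"
  shows "summable (\<lambda>n. (of_nat (n + 1) * of_nat (n + 2)) * r ^ n)"
proof -
  have 1: "summable (\<lambda>n. diffs (\<lambda>_. 1) n * x ^ n)" if "norm x < 1" for x :: real
    by (rule termdiff_converges[where K = 1]) (use that in \<open>auto intro: summable_geometric\<close>)
  have "summable (\<lambda>n. diffs (diffs (\<lambda>_. 1)) n * r ^ n)"
    by (rule termdiff_converges[where K = 1]) (use assms 1 in auto)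
  then show ?thesis by (simp add: diffs_def algebra_simps)
qed

lemma fps_to_fls_sum: "fps_to_fls (\<Sum>i\<in>A. f i) = (\<Sum>i\<in>A. fps_to_fls (f i))"
  by (induction A rule: infinite_finite_induct) simp_all

text \<open>A Liouville-type argument: substituting \<open>G K\<close> into a polynomial relation
  for \<open>f\<close> gives a polynomial whose order of vanishing at 0 would exceed its degree, so
  it is zero. A nonzero \<open>R\<close> cannot have infinitely many such roots.\<close>

lemma transcendental_function_if_rapidly_approximable:
  fixes f :: "complex fps" and G :: "nat \<Rightarrow> complex poly"
  assumes inj: "inj G"
    and approx: "\<And>d. \<forall>\<^sub>F K in sequentially.
      fps_X ^ (d * (degree (G K) + 1)) dvd f - fps_of_poly (G K)"
  shows "transcendental_function f"
  unfolding transcendental_function_def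
proof
  assume "algebraic_over rational_functions (fps_to_fls f)"
  then obtain p where p: "\<And>i. coeff p i \<in> rational_functions" "p \<noteq> 0" "poly p (fps_to_fls f) = 0"
    unfolding algebraic_over_def by blast
  define \<phi> :: "complex poly \<Rightarrow> complex fls" where "\<phi> q = fps_to_fls (fps_of_poly q)" for q
  have \<phi>_mult: "\<phi> (q * r) = \<phi> q * \<phi> r" for q r
    by (simp add: \<phi>_def fps_of_poly_mult fls_times_fps_to_fls)
  have \<phi>_eq_0: "\<phi> q = 0 \<longleftrightarrow> q = 0" for q
    using fps_of_poly_eq_iff[of q 0] by (simp add: \<phi>_def)
  have "\<exists>u v. v \<noteq> 0 \<and> coeff p i = \<phi> u / \<phi> v" for i
    using p(1)[of i] unfolding rational_functions_def \<phi>_def by blast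
  then obtain u v where uv: "\<And>i. v i \<noteq> 0" "\<And>i. coeff p i = \<phi> (u i) / \<phi> (v i)" by metis
  \<comment> \<open>A common denominator turns the relation into one with coefficients in
    C[z].\<close>
  define V where "V = (\<Prod>i\<le>degree p. v i)"
  have V: "V \<noteq> 0" unfolding V_def using uv(1) by simp
  have "\<exists>w. \<phi> V * coeff p i = \<phi> w" for i
  proof (cases "i \<le> degree p")
    case True
    then have "V = v i * (\<Prod>j\<in>{..degree p} - {i}. v j)"
      unfolding V_def by (subst prod.remove[of _ i]) auto
    then have "\<phi> V * coeff p i = \<phi> (u i * (\<Prod>j\<in>{..degree p} - {i}. v j))"
      using uv(1)[of i] by (simp add: uv(2) \<phi>_mult \<phi>_eq_0)
    then show ?thesis by blast
  next
    case False
    then show ?thesis by (intro exI[of _ 0]) (simp add: coeff_eq_0 \<phi>_eq_0)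
  qed
  then obtain w where w: "\<And>i. \<phi> V * coeff p i = \<phi> (w i)" by metis
  define R where "R = (\<Sum>i\<le>degree p. monom (w i) i)"
  have "w (degree p) \<noteq> 0"
    using w[of "degree p"] V p(2) \<phi>_eq_0 by (metis leading_coeff_0_iff mult_eq_0_iff)
  moreover have "coeff R (degree p) = w (degree p)" by (simp add: R_def coeff_sum)
  ultimately have R: "R \<noteq> 0" by auto
  have "fps_to_fls (\<Sum>i\<le>degree p. fps_of_poly (w i) * f ^ i)
      = (\<Sum>i\<le>degree p. \<phi> (w i) * fps_to_fls f ^ i)"
    by (simp add: \<phi>_def fps_to_fls_sum fls_times_fps_to_fls fps_to_fls_power)
  also have "\<dots> = \<phi> V * poly p (fps_to_fls f)"
    by (simp add: poly_altdef sum_distrib_left w[symmetric] mult.assoc)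
  finally have f0: "(\<Sum>i\<le>degree p. fps_of_poly (w i) * f ^ i) = 0"
    using p(3) by simp
  have R_eq: "fps_of_poly (poly R F) = (\<Sum>i\<le>degree p. fps_of_poly (w i) * fps_of_poly F ^ i)" for F
    by (simp add: R_def poly_sum poly_monom fps_of_poly_sum fps_of_poly_mult fps_of_poly_power)
  \<comment> \<open>As \<open>f\<close> is a root of \<open>R\<close>, \<open>poly R F\<close> is a
    combination of the differences of powers of \<open>F\<close> and \<open>f\<close>, each
    divisible by \<open>f - F\<close>.\<close>
  have dvd: "f - fps_of_poly F dvd fps_of_poly (poly R F)" for F
  proof -
    have "f - fps_of_poly F dvd f ^ i - fps_of_poly F ^ i" for i
      by (simp add: power_diff_sumr2)
    then have "f - fps_of_poly F dvd
        (\<Sum>i\<le>degree p. fps_of_poly (w i) * (f ^ i - fps_of_poly F ^ i))"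
      by (intro dvd_sum dvd_mult)
    also have "\<dots> = - fps_of_poly (poly R F)"
      by (simp add: R_eq right_diff_distrib sum_subtractf f0)
    finally show ?thesis by simp
  qed
  obtain D d where deg: "\<And>F. degree (poly R F) \<le> D + d * degree F"
    using degree_poly_le[of R] by blast
  have "\<forall>\<^sub>F K in sequentially. poly R (G K) = 0"
    using approx[of "D + d + 1"]
  proof eventually_elim
    case (elim K)
    \<comment> \<open>The multiplier \<open>D + d + 1\<close> is chosen so that \<open>?m\<close>
      exceeds the degree bound \<open>D + d * degree (G K)\<close>.\<close>
    let ?m = "(D + d + 1) * (degree (G K) + 1)"
    have "fps_X ^ ?m dvd fps_of_poly (poly R (G K))"
      using elim dvd dvd_trans by blast
    then have "coeff (poly R (G K)) i = 0" if "i < ?m" for i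
      using that unfolding fps_X_power_dvd_iff by simp
    moreover have "degree (poly R (G K)) < ?m"
      using deg[of "G K"] by (simp add: algebra_simps)
    ultimately show ?case by (metis leading_coeff_0_iff)
  qed
  then obtain N where "\<And>K. K \<ge> N \<Longrightarrow> poly R (G K) = 0"
    unfolding eventually_sequentially by blast
  then have "G ` {N..} \<subseteq> {x. poly R x = 0}" by auto
  then have "finite (G ` {N..})" using poly_roots_finite[OF R] finite_subset by blast
  then show False using inj by (simp add: finite_image_iff inj_on_subset infinite_Ici)
qed

section \<open>Power series built from lacunary blocks\<close>

text \<open>The growing factor \<open>Suc k\<close> in \<open>gap\<close> beats every fixed multiple
  of the degree, which gives transcendence; \<open>bound\<close> makes the coefficients grow
  polynomially in the exponent, which gives convergence on the disc.\<close>

locale lacunary_blocks =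
  fixes g :: "nat \<Rightarrow> int poly" and m :: "nat \<Rightarrow> nat"
  assumes nonzero: "g k \<noteq> 0"
    and start: "coeff (g k) n \<noteq> 0 \<Longrightarrow> m k \<le> n"
    and gap: "Suc k * (degree (g k) + 1) < m (Suc k)"
    and bound: "\<bar>coeff (g k) n\<bar> \<le> int (m k)"
begin

definition partial :: "nat \<Rightarrow> int poly" where
  "partial K = (\<Sum>k<K. g k)"

text \<open>Since \<open>k \<le> m k\<close>, blocks with index above \<open>n\<close> start beyond
  exponent \<open>n\<close>, so \<open>partial (Suc n)\<close> already has the final
  coefficient.\<close>

definition series :: "complex fps" where
  "series = Abs_fps (\<lambda>n. of_int (coeff (partial (Suc n)) n))"

lemma start_le_degree: "m k \<le> degree (g k)"
  using start[of k "degree (g k)"] nonzero by simp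

lemma degree_less: "degree (g k) < m (Suc k)"
  using gap[of k] by simp

lemma strict_mono_start: "strict_mono m"
  unfolding strict_mono_Suc_iff using start_le_degree degree_less le_less_trans by blast

lemma le_start: "k \<le> m k"
  using strict_mono_start by (rule strict_mono_imp_increasing)

lemma degree_partial: "degree (partial (Suc k)) \<le> degree (g k)"
proof -
  have "degree (g i) \<le> degree (g (Suc i))" for i
    using degree_less[of i] start_le_degree[of "Suc i"] by linarith
  then have "degree (g i) \<le> degree (g k)" if "i \<le> k" for i
    using that by (rule lift_Suc_mono_le)
  then show ?thesis unfolding partial_def by (intro degree_sum_le) auto
qed

lemma coeff_partial_eq_0:
  assumes "m K \<le> n"
  shows "coeff (partial K) n = 0"
proof -
  have "coeff (g k) n = 0" if "k < K" for k
  proof -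
    have "m (Suc k) \<le> m K" using that strict_mono_start by (simp add: strict_mono_less_eq)
    then show ?thesis using degree_less[of k] assms by (intro coeff_eq_0) linarith
  qed
  then show ?thesis by (simp add: partial_def coeff_sum)
qed

lemma coeff_partial_stable:
  assumes "K \<le> L" "n < m K"
  shows "coeff (partial L) n = coeff (partial K) n"
proof -
  have "coeff (g k) n = 0" if "K \<le> k" for k
  proof -
    have "m K \<le> m k" using that strict_mono_start by (simp add: strict_mono_less_eq)
    then show ?thesis using start[of k n] assms by fastforce
  qed
  then show ?thesis unfolding partial_def coeff_sum
    using assms by (intro sum.mono_neutral_right) auto
qed

lemma series_nth: "n < m K \<Longrightarrow> fps_nth series n = of_int (coeff (partial K) n)"
  using coeff_partial_stable[of K "max K (Suc n)" n]
    coeff_partial_stable[of "Suc n" "max K (Suc n)" n] le_start[of "Suc n"]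
  by (simp add: series_def)

text \<open>The leading term of the last block of the longer sum lies beyond all earlier blocks and
  cannot cancel.\<close>

lemma inj_partial: "inj partial"
proof (rule linorder_injI)
  fix K L :: nat
  assume "K < L"
  then obtain l where l: "L = Suc l" "K \<le> l" by (cases L) auto
  let ?n = "degree (g l)"
  have "coeff (partial l) ?n = 0" by (intro coeff_partial_eq_0 start_le_degree)
  then have "coeff (partial L) ?n \<noteq> 0"
    using nonzero[of l] by (simp add: l partial_def)
  moreover have "m K \<le> ?n"
    using l strict_mono_start start_le_degree[of l] by (meson strict_mono_less_eq order_trans)
  then have "coeff (partial K) ?n = 0" by (rule coeff_partial_eq_0)
  ultimately show "partial K \<noteq> partial L" by auto
qed

lemma transcendental_series: "transcendental_function series"
proof (rule transcendental_function_if_rapidly_approximable)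
  show "inj (\<lambda>K. map_poly complex_of_int (partial K))"
  proof (rule injI)
    fix K L
    assume "map_poly complex_of_int (partial K) = map_poly complex_of_int (partial L)"
    then have "coeff (partial K) n = coeff (partial L) n" for n
      by (metis coeff_map_poly of_int_0 of_int_eq_iff)
    then show "K = L" using inj_partial by (metis injD poly_eqI)
  qed
  fix d
  show "\<forall>\<^sub>F K in sequentially.
      fps_X ^ (d * (degree (map_poly complex_of_int (partial K)) + 1)) dvd
        series - fps_of_poly (map_poly complex_of_int (partial K))"
    using eventually_ge_at_top[of "Suc d"]
  proof eventually_elim
    case (elim K)
    \<comment> \<open>With \<open>d \<le> k\<close>, the factor \<open>Suc k\<close> in
      \<open>gap\<close> dominates \<open>d\<close>.\<close>
    then obtain k where K: "K = Suc k" "d \<le> k" by (cases K) auto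
    have "d * (degree (partial K) + 1) \<le> Suc k * (degree (g k) + 1)"
      using K degree_partial[of k] by (intro mult_mono) auto
    also have "\<dots> < m K" using gap K by simp
    finally have "d * (degree (partial K) + 1) < m K" .
    then show ?case
      unfolding fps_X_power_dvd_iff
      by (auto simp: degree_map_poly coeff_map_poly series_nth[of _ K])
  qed
qed

text \<open>At most \<open>n + 1\<close> blocks reach exponent \<open>n\<close>, and each of them
  has \<open>m k \<le> n\<close>, so \<open>bound\<close> applies. The slack in \<open>n + 2\<close>
  fits the twice differentiated geometric series.\<close>

lemma norm_series_nth: "norm (fps_nth series n) \<le> of_nat (n + 1) * of_nat (n + 2)"
proof -
  have "\<bar>coeff (g k) n\<bar> \<le> int (n + 2)" for k
    using start[of k n] bound[of k n] by (cases "coeff (g k) n = 0") auto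
  then have "\<bar>coeff (partial (Suc n)) n\<bar> \<le> (\<Sum>k<Suc n. int (n + 2))"
    unfolding partial_def coeff_sum by (intro order_trans[OF sum_abs] sum_mono)
  then have "\<bar>coeff (partial (Suc n)) n\<bar> \<le> int ((n + 1) * (n + 2))"
    by (simp add: algebra_simps)
  then have "real_of_int \<bar>coeff (partial (Suc n)) n\<bar> \<le> real ((n + 1) * (n + 2))"
    by linarith
  then show ?thesis by (simp add: series_def algebra_simps)
qed

lemma summable_series:
  assumes "norm z < 1"
  shows "summable (\<lambda>n. fps_nth series n * z ^ n)"
proof (rule summable_comparison_test')
  show "summable (\<lambda>n. of_nat (n + 1) * of_nat (n + 2) * norm z ^ n)"
    using assms by (intro summable_square_times_geometric) simp
  show "norm (fps_nth series n * z ^ n) \<le> of_nat (n + 1) * of_nat (n + 2) * norm z ^ n"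
    if "n \<ge> 0" for n
    unfolding norm_mult norm_power by (intro mult_right_mono norm_series_nth) simp
qed

lemma series_in_int_series_on_disc: "series \<in> int_series_on_disc"
  using summable_series by (auto simp: int_series_on_disc_def series_def)

text \<open>Truncating the convergent series at the exponents \<open>m K\<close> gives the values of
  \<open>partial K\<close>, which are constant from \<open>N\<close> on.\<close>

lemma eval_series:
  assumes "norm z < 1" and vanish: "\<And>k. k \<ge> N \<Longrightarrow> ipoly (g k) z = 0"
  shows "eval_fps series z = ipoly (partial N) z"
proof -
  have sum_eq: "(\<Sum>n<m K. fps_nth series n * z ^ n) = ipoly (partial K) z" for K
  proof -
    have "degree (partial K) < m K \<or> partial K = 0"
      using coeff_partial_eq_0[of K "degree (partial K)"] by (metis leading_coeff_0_iff not_le)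
    then show ?thesis by (simp add: ipoly_altdef series_nth)
  qed
  have "(\<lambda>n. \<Sum>i<n. fps_nth series i * z ^ i) \<longlonglongrightarrow> eval_fps series z"
    unfolding eval_fps_def using summable_series[OF assms(1)] by (rule summable_LIMSEQ)
  then have "(\<lambda>K. ipoly (partial K) z) \<longlonglongrightarrow> eval_fps series z"
    by (drule_tac LIMSEQ_subseq_LIMSEQ[OF _ strict_mono_start]) (simp add: o_def sum_eq)
  moreover have "ipoly (partial K) z = ipoly (partial N) z" if "K \<ge> N" for K
    unfolding partial_def ipoly_sum
    using that vanish by (intro sum.mono_neutral_right) auto
  then have "(\<lambda>K. ipoly (partial K) z) \<longlonglongrightarrow> ipoly (partial N) z"
    by (intro tendsto_eventually eventually_mono[OF eventually_ge_at_top[of N]])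
  ultimately show ?thesis by (rule LIMSEQ_unique)
qed

lemma series_support:
  assumes "fps_nth series n \<noteq> 0"
  obtains k where "coeff (g k) n \<noteq> 0"
proof -
  have "(\<Sum>k<Suc n. coeff (g k) n) \<noteq> 0"
    using assms by (simp add: series_def partial_def coeff_sum del: sum.lessThan_Suc of_int_sum)
  then show thesis using that by (elim sum.not_neutral_contains_not_neutral)
qed

end

text \<open>The coefficients below \<open>m K\<close> recover \<open>partial K\<close>, and
  consecutive partial sums differ by one block.\<close>

lemma lacunary_series_eq_imp_blocks_eq:
  assumes "lacunary_blocks g m" "lacunary_blocks h m"
    and eq: "lacunary_blocks.series g = lacunary_blocks.series h"
  shows "g = h"
proof
  fix k
  interpret g: lacunary_blocks g m by fact
  interpret h: lacunary_blocks h m by fact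
  have "g.partial K = h.partial K" for K
  proof (rule poly_eqI)
    fix n
    show "coeff (g.partial K) n = coeff (h.partial K) n"
      using g.series_nth[of n K] h.series_nth[of n K] eq
        g.coeff_partial_eq_0[of K n] h.coeff_partial_eq_0[of K n]
      by (cases "n < m K") auto
  qed
  from this[of "Suc k"] this[of k] show "g k = h k"
    by (simp add: g.partial_def h.partial_def)
qed

section \<open>Polynomials with prescribed support vanishing at algebraic points\<close>

lemma eventually_vanishing_int_polys:
  fixes a :: "nat \<Rightarrow> nat"
  assumes "inj a"
  shows "\<exists>(Q :: nat \<Rightarrow> int poly) d. (\<forall>k. Q k \<noteq> 0) \<and> (\<forall>k n. coeff (Q k) n \<noteq> 0 \<longrightarrow> (\<exists>i\<le>d k. n = a i)) \<and>
    (\<forall>x. algebraic x \<longrightarrow> (\<exists>N. \<forall>k\<ge>N. ipoly (Q k) x = 0))"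
proof -
  \<comment> \<open>Decoding naturals as coefficient lists enumerates all integer polynomials; 1
    replaces the zero polynomial to keep the products \<open>P k\<close> nonzero.\<close>
  define e :: "nat \<Rightarrow> int poly" where
    "e i = (if Poly (from_nat i) = (0 :: int poly) then 1 else Poly (from_nat i))" for i
  define P where "P k = (\<Prod>i\<le>k. e i)" for k
  have P: "P k \<noteq> 0" for k by (simp add: P_def e_def)
  have "\<exists>c. (\<exists>i\<le>degree (P k). c i \<noteq> 0) \<and> (\<forall>x. ipoly (P k) x = 0 \<longrightarrow>
      (\<Sum>i\<le>degree (P k). of_int (c i) * ipoly (monom 1 (a i)) x) = 0)" for k
    by (rule int_poly_relation_on_roots[OF P[of k], of "\<lambda>i. monom 1 (a i)"]) blast
  then obtain c where c: "\<And>k. \<exists>i\<le>degree (P k). c k i \<noteq> 0"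
    "\<And>k x. ipoly (P k) x = 0 \<Longrightarrow>
      (\<Sum>i\<le>degree (P k). of_int (c k i) * ipoly (monom 1 (a i)) x) = 0"
    by metis
  define Q where "Q k = (\<Sum>i\<le>degree (P k). monom (c k i) (a i))" for k
  show ?thesis
  proof (intro exI[of _ Q] exI[of _ "\<lambda>k. degree (P k)"] conjI allI impI)
    fix k
    obtain i where i: "i \<le> degree (P k)" "c k i \<noteq> 0" using c(1) by blast
    \<comment> \<open>Injectivity of \<open>a\<close> prevents distinct monomials from
      merging.\<close>
    have "coeff (Q k) (a i) = (\<Sum>j\<le>degree (P k). if j = i then c k j else 0)"
      unfolding Q_def coeff_sum using assms by (intro sum.cong) (auto dest: injD)
    also have "\<dots> = c k i" using i by simp
    finally show "Q k \<noteq> 0" using i by auto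
    show "\<exists>i\<le>degree (P k). n = a i" if "coeff (Q k) n \<noteq> 0" for n
      using that unfolding Q_def coeff_sum
      by (auto elim!: sum.not_neutral_contains_not_neutral split: if_splits)
  next
    fix x :: complex
    assume "algebraic x"
    then obtain p where p: "p \<noteq> 0" "ipoly p x = 0" using algebraicE' by blast
    define N where "N = to_nat (coeffs p)"
    have eN: "e N = p" using p by (simp add: e_def N_def)
    have "ipoly (Q k) x = 0" if "k \<ge> N" for k
    proof -
      have "P k = e N * (\<Prod>i\<in>{..k} - {N}. e i)"
        unfolding P_def using that by (subst prod.remove[of _ N]) auto
      then have "ipoly (P k) x = 0" using p(2) by (simp add: eN ipoly_mult)
      from c(2)[OF this] show ?thesis by (simp add: Q_def ipoly_sum ipoly_monom)
    qed
    then show "\<exists>N. \<forall>k\<ge>N. ipoly (Q k) x = 0" by blast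
  qed
qed

section \<open>The uncountable family\<close>

lemma uncountable_UNIV_nat_set: "uncountable (UNIV :: nat set set)"
proof
  assume "countable (UNIV :: nat set set)"
  then have "range (from_nat_into (UNIV :: nat set set)) = UNIV"
    by (intro range_from_nat_into) auto
  then show False using Cantors_theorem[of "UNIV :: nat set"] by auto
qed

theorem theorem1p4:
  fixes A B :: "nat set"
  assumes "infinite A" and "infinite B"
  shows "uncountable {f \<in> int_series_on_disc.
           (\<forall>n. n \<notin> upper_sumset A B \<longrightarrow> fps_nth f n = 0) \<and>
           transcendental_function f \<and>
           eval_fps f ` (algebraic_numbers \<inter> ball 0 1) \<subseteq> algebraic_numbers}"
    (is "uncountable ?F")
proof -
  have "inj (enumerate A)"
    using assms(1) by (simp add: strict_mono_enumerate strict_mono_imp_inj_on)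
  then obtain Q :: "nat \<Rightarrow> int poly" and d where Q: "\<And>k. Q k \<noteq> 0"
    "\<And>k n. coeff (Q k) n \<noteq> 0 \<Longrightarrow> \<exists>i\<le>d k. n = enumerate A i"
    "\<And>x. algebraic x \<Longrightarrow> \<exists>N. \<forall>k\<ge>N. ipoly (Q k) x = 0"
    using eventually_vanishing_int_polys by blast
  define H where "H k = (\<Sum>n\<le>degree (Q k). nat \<bar>coeff (Q k) n\<bar>)" for k
  have H: "\<bar>coeff (Q k) n\<bar> \<le> int (H k)" for k n
  proof (cases "n \<le> degree (Q k)")
    case True
    then have "nat \<bar>coeff (Q k) n\<bar> \<le> H k" unfolding H_def by (intro member_le_sum) auto
    then show ?thesis by linarith
  qed (simp add: coeff_eq_0)
  \<comment> \<open>The part \<open>d k + 1\<close> will put every index \<open>i \<le> d k\<close>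
    used from \<open>A\<close> strictly below \<open>J k\<close>; \<open>2 * H k\<close> bounds the
    coefficients even after doubling.\<close>
  define W where "W k = d k + 1 + 2 * H k" for k
  \<comment> \<open>\<open>J k\<close> is the index in \<open>B\<close> of the shift of block
    \<open>k\<close>. The product term enforces \<open>gap\<close>, because
    \<open>enumerate B j \<ge> j\<close> and block \<open>k\<close> has degree
    \<open>m k + degree (Q k)\<close>.\<close>
  define J where "J = rec_nat (W 0)
    (\<lambda>k j. W (Suc k) + Suc k * (enumerate B j + degree (Q k) + 1) + 1)"
  define m where "m k = enumerate B (J k)" for k
  have J_Suc: "J (Suc k) = W (Suc k) + Suc k * (m k + degree (Q k) + 1) + 1" for k
    by (simp add: J_def m_def)
  have W_le: "W k \<le> J k" for k
    by (cases k) (simp_all add: J_def)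
  have J_le: "J k \<le> m k" for k
    unfolding m_def using assms(2) by (rule le_enumerate)
  \<comment> \<open>The set \<open>X\<close> encodes the choice of factors: 2 on \<open>X\<close>
    and 1 elsewhere. Both are nonzero, so the support does not depend on \<open>X\<close>.\<close>
  define g where "g X k = smult (if k \<in> X then 2 else 1) (monom 1 (m k) * Q k)" for X k
  have coeff_g: "coeff (g X k) n =
      (if n < m k then 0 else (if k \<in> X then 2 else 1) * coeff (Q k) (n - m k))" for X k n
    by (auto simp: g_def coeff_monom_mult)
  have blocks: "lacunary_blocks (g X) m" for X
  proof
    fix k n
    show "g X k \<noteq> 0" using Q(1) by (simp add: g_def)
    show "coeff (g X k) n \<noteq> 0 \<Longrightarrow> m k \<le> n" by (simp add: coeff_g split: if_splits)
    have "degree (g X k) = m k + degree (Q k)"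
      using Q(1) by (simp add: g_def degree_mult_eq degree_monom_eq)
    then show "Suc k * (degree (g X k) + 1) < m (Suc k)"
      using J_Suc[of k] J_le[of "Suc k"] by simp
    show "\<bar>coeff (g X k) n\<bar> \<le> int (m k)"
      using H[of k "n - m k"] W_le[of k] J_le[of k] by (auto simp: coeff_g W_def abs_mult)
  qed
  define f where "f X = lacunary_blocks.series (g X)" for X
  have f_mem: "f X \<in> ?F" for X
  proof -
    interpret lacunary_blocks "g X" m by (rule blocks)
    have "n \<in> upper_sumset A B" if n: "fps_nth (f X) n \<noteq> 0" for n
    proof -
      obtain k where "coeff (g X k) n \<noteq> 0" using n series_support unfolding f_def by blast
      then have k: "m k \<le> n" "coeff (Q k) (n - m k) \<noteq> 0"
        by (auto simp: coeff_g split: if_splits)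
      then obtain i where i: "i \<le> d k" "n - m k = enumerate A i" using Q(2) by blast
      \<comment> \<open>This is the condition \<open>i < j\<close> in
        \<open>upper_sumset\<close>.\<close>
      have "i < J k" using i W_le[of k] by (simp add: W_def)
      moreover have "n = enumerate A i + enumerate B (J k)" using i k by (simp add: m_def)
      ultimately show ?thesis unfolding upper_sumset_def by blast
    qed
    moreover have "algebraic (eval_fps (f X) z)" if z: "algebraic z" "norm z < 1" for z
    proof -
      obtain N where "\<forall>k\<ge>N. ipoly (Q k) z = 0" using Q(3)[OF z(1)] by blast
      then have "ipoly (g X k) z = 0" if "k \<ge> N" for k
        using that by (simp add: g_def ipoly_smult ipoly_mult)
      then have "eval_fps (f X) z = ipoly (partial N) z"
        unfolding f_def using z(2) by (intro eval_series)
      then show ?thesis using algebraic_ipoly[OF z(1)] by simp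
    qed
    ultimately show ?thesis
      using series_in_int_series_on_disc transcendental_series
      unfolding f_def algebraic_numbers_def by auto
  qed
  have "inj f"
  proof (rule injI)
    fix X Y
    assume "f X = f Y"
    then have "g X = g Y"
      unfolding f_def by (rule lacunary_series_eq_imp_blocks_eq[OF blocks blocks])
    have "k \<in> X \<longleftrightarrow> k \<in> Y" for k
    proof -
      \<comment> \<open>The leading coefficient of \<open>Q k\<close> is nonzero, so the factor 1 or
        2 can be read off there.\<close>
      have "coeff (g X k) (m k + degree (Q k)) = coeff (g Y k) (m k + degree (Q k))"
        using \<open>g X = g Y\<close> by simp
      then show ?thesis using Q(1)[of k] by (auto simp: coeff_g split: if_splits)
    qed
    then show "X = Y" by blast
  qed
  then have "uncountable (range f)"
    using uncountable_UNIV_nat_set countable_image_inj_on[of f UNIV] by metis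
  moreover have "range f \<subseteq> ?F" using f_mem by (rule image_subsetI)
  ultimately show ?thesis by (rule contrapos_nn[OF _ countable_subset])
qed

end
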